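(* Let $t,s\in\mathrm{PT}_\Omega$ be trees, let $k+1$ be the number of nodes on the rightmost branch of $t$ and $l+1$ the number of nodes on the leftmost branch of $s$. (1) If $\Omega$ is a set, the dendriform products $<,>$ on $\mathcal{PT}_\Omega$ satisfy $$t<s=\sum_{\substack{\sigma\in\mathrm{Sh}(k+1,l+1)\\ \sigma^{-1}(\{1\})=\{1\}}}\sigma(t,s),\qquad t>s=\sum_{\substack{\sigma\in\mathrm{Sh}(k+1,l+1)\\ \sigma^{-1}(\{1\})=\{k+2\}}}\sigma(t,s).$$ (2) If $(\Omega,+)$ is a semigroup, the tridendriform products $<,>,\bullet$ on $\mathcal{PT}_\Omega$ satisfy $$t<s=\sum_{\substack{\sigma\in\mathrm{QSh}(k+1,l+1)\\ \sigma^{-1}(\{1\})=\{1\}}}\sigma(t,s),\qquad t>s=\sum_{\substack{\sigma\in\mathrm{QSh}(k+1,l+1)\\ \sigma^{-1}(\{1\})=\{k+2\}}}\sigma(t,s),\qquad t\bullet s=\sum_{\substack{\sigma\in\mathrm{QSh}(k+1,l+1)\\ \sigma^{-1}(\{1\})=\{1,k+2\}}}\sigma(t,s).$$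
   Context: $\mathbb K$ is a fixed field. A planar rooted tree is a finite rooted tree in which the children of every vertex are linearly ordered from left to right. $\mathrm{PT}_\Omega$ is the set of non-empty planar rooted trees with vertices decorated by $\Omega$, and $\mathcal{PT}_\Omega$ the $\mathbb K$-vector space with basis $\mathrm{PT}_\Omega$. A planar forest is a finite (possibly empty) ordered sequence of planar trees. $B_+^x(T_1\cdots T_k)$ is the tree obtained by grafting $T_1,\dots,T_k$ in this order on a new root decorated by $x$ (extended multilinearly); $B_+^x(\emptyset)$ is the one-vertex tree. Tree products. For $S=B_+^x(S_1\cdots S_k)$, $T=B_+^y(T_1\cdots T_\ell)$ with $k,\ell\ge0$, define by induction on the total number of vertices and bilinearity $S<T:=B_+^x(S_1\cdots S_{k-1}(S_k\ast T))$ if $k\ge1$ and $B_+^x(T)$ if $k=0$; $S>T:=B_+^y((S\ast T_1)T_2\cdots T_\ell)$ if $\ell\ge1$ and $B_+^y(S)$ if $\ell=0$. For the dendriform products ($\Omega$ a set), $\ast:={<}+{>}$. For the tridendriform products ($(\Omega,+)$ a semigroup), $\ast:={<}+{>}+\bullet$, where $S\bullet T:=B_+^{x+y}(S_1\cdots S_{k-1}(S_k\ast T_1)T_2\cdots T_\ell)$ if $k,\ell\ge1$, $B_+^{x+y}(T_1\cdots T_\ell)$ if $k=0$, $B_+^{x+y}(S_1\cdots S_k)$ if $\ell=0$. Combs. The rightmost (resp. leftmost) branch of a tree is the path starting at the root and going at each step to the last (resp. first) child, until a leaf. For $t$, let the nodes of its rightmost branch, from root to leaf, be decorated by $\omega_1,\dots,\omega_{k+1}$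 and let $F_i$ ($1\le i\le k$) be the forest of subtrees attached to the $i$-th node other than the one containing the next node of the branch; $F_{k+1}=\emptyset$. For $s$, let the nodes of its leftmost branch, from root to leaf, be decorated by $\omega_{k+2},\dots,\omega_{k+l+2}$ and let $F_{k+1+j}$ ($1\le j\le l$) be the forest of subtrees attached to the $j$-th node other than the one containing the next node of the branch; $F_{k+l+2}=\emptyset$. Quasi-shuffles. For $p,q\ge1$, a $(p,q)$-quasi-shuffle is a surjection $\sigma:\{1,\dots,p+q\}\to\{1,\dots,n\}$, for some $n\ge 1$, with $\sigma(1)<\dots<\sigma(p)$ and $\sigma(p+1)<\dots<\sigma(p+q)$; their set is $\mathrm{QSh}(p,q)$, and $\mathrm{Sh}(p,q)$ is the subset of bijective ones. The tree $\sigma(t,s)$, for $\sigma\in\mathrm{QSh}(k+1,l+1)$ with image $\{1,\dots,n\}$: take the ladder with nodes $1,\dots,n$ (node $1$ the root, node $j+1$ a child of node $j$); for $1\le i\le k+1$ graft the forest $F_i$ on node $\sigma(i)$, to the left of the ladder; for $k+2\le i\le k+l+2$ graft $F_i$ on node $\sigma(i)$, to the right of the ladder; decorate node $j$ by $\omega_i$ if $\sigma^{-1}(\{j\})=\{i\}$, and by $\omega_i+\omega_r$ if $\sigma^{-1}(\{j\})=\{i,r\}$ with $i\le k+1<r$. *)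

theory Defs
  imports "HOL-Library.Poly_Mapping" "HOL-Library.FuncSet"
begin

text \<open>
  \<^term>\<open>Node x ts\<close> is the grafting \<open>B\<^sub>+\<close> of the forest \<^term>\<open>ts\<close> on a new root decorated by
  \<^term>\<open>x\<close>. The vector space with basis the trees is \<open>'w ptree \<Rightarrow>\<^sub>0 'k\<close>, the tree \<open>t\<close> being identified
  with the basis vector \<open>basis t\<close>.
\<close>

datatype 'w ptree = Node (decor: 'w) (children: "'w ptree list")

definition basis :: "'a \<Rightarrow> ('a \<Rightarrow>\<^sub>0 'k::field)" where
  "basis a = Poly_Mapping.single a 1"

definition scale :: "'k::field \<Rightarrow> ('a \<Rightarrow>\<^sub>0 'k) \<Rightarrow> ('a \<Rightarrow>\<^sub>0 'k)" where
  "scale c v = Poly_Mapping.map ((*) c) v"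

definition lin_ext :: "('a \<Rightarrow> ('b \<Rightarrow>\<^sub>0 'k)) \<Rightarrow> ('a \<Rightarrow>\<^sub>0 'k::field) \<Rightarrow> ('b \<Rightarrow>\<^sub>0 'k)" where
  "lin_ext f v = (\<Sum>a\<in>Poly_Mapping.keys v. scale (Poly_Mapping.lookup v a) (f a))"

definition bilin_ext ::
  "('a \<Rightarrow> 'b \<Rightarrow> ('c \<Rightarrow>\<^sub>0 'k)) \<Rightarrow> ('a \<Rightarrow>\<^sub>0 'k::field) \<Rightarrow> ('b \<Rightarrow>\<^sub>0 'k) \<Rightarrow> ('c \<Rightarrow>\<^sub>0 'k)" where
  "bilin_ext f u v = lin_ext (\<lambda>a. lin_ext (f a) v) u"

text \<open>
  The operator \<open>B\<^sub>+\<close> applied to a forest in which one tree, placed between the forests \<open>ls\<close> and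
  \<open>rs\<close>, is replaced by a linear combination of trees.
\<close>

definition graft ::
  "'w \<Rightarrow> 'w ptree list \<Rightarrow> ('w ptree \<Rightarrow>\<^sub>0 'k::field) \<Rightarrow> 'w ptree list \<Rightarrow> ('w ptree \<Rightarrow>\<^sub>0 'k)" where
  "graft x ls v rs = lin_ext (\<lambda>u. basis (Node x (ls @ u # rs))) v"

lemma lin_ext_basis [simp]: "lin_ext f (basis a) = f a"
  by (simp add: lin_ext_def basis_def scale_def, transfer, auto simp: when_def fun_eq_iff)

lemma bilin_ext_basis [simp]: "bilin_ext f (basis a) (basis b) = f a b"
  by (simp add: bilin_ext_def)

lemma size_last_less:
  "ts \<noteq> [] \<Longrightarrow> size (last ts) < Suc (size_list size ts)"
  by (meson last_in_set le_imp_less_Suc order_refl size_list_estimation')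

function dend_lt0 :: "'w ptree \<Rightarrow> 'w ptree \<Rightarrow> ('w ptree \<Rightarrow>\<^sub>0 'k::field)"
  and dend_gt0 :: "'w ptree \<Rightarrow> 'w ptree \<Rightarrow> ('w ptree \<Rightarrow>\<^sub>0 'k)"
where
  "dend_lt0 (Node x ss) T =
     (if ss = [] then basis (Node x [T])
      else graft x (butlast ss) (dend_lt0 (last ss) T + dend_gt0 (last ss) T) [])"
| "dend_gt0 S (Node y ts) =
     (case ts of [] \<Rightarrow> basis (Node y [S])
      | T1 # us \<Rightarrow> graft y [] (dend_lt0 S T1 + dend_gt0 S T1) us)"
  by pat_completeness auto
termination
  by (relation "measure (case_sum (\<lambda>(S, T). size S + size T) (\<lambda>(S, T). size S + size T))")
     (auto dest: size_last_less)

definition dend_lt :: "('w ptree \<Rightarrow>\<^sub>0 'k::field) \<Rightarrow> ('w ptree \<Rightarrow>\<^sub>0 'k) \<Rightarrow> ('w ptree \<Rightarrow>\<^sub>0 'k)" where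
  "dend_lt = bilin_ext dend_lt0"

definition dend_gt :: "('w ptree \<Rightarrow>\<^sub>0 'k::field) \<Rightarrow> ('w ptree \<Rightarrow>\<^sub>0 'k) \<Rightarrow> ('w ptree \<Rightarrow>\<^sub>0 'k)" where
  "dend_gt = bilin_ext dend_gt0"

text \<open>
  The law of the semigroup of decorations is the explicit parameter \<open>add\<close>; its associativity is not
  needed for the definitions.
\<close>

function tri_lt0 :: "('w \<Rightarrow> 'w \<Rightarrow> 'w) \<Rightarrow> 'w ptree \<Rightarrow> 'w ptree \<Rightarrow> ('w ptree \<Rightarrow>\<^sub>0 'k::field)"
  and tri_gt0 :: "('w \<Rightarrow> 'w \<Rightarrow> 'w) \<Rightarrow> 'w ptree \<Rightarrow> 'w ptree \<Rightarrow> ('w ptree \<Rightarrow>\<^sub>0 'k)"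
  and tri_dot0 :: "('w \<Rightarrow> 'w \<Rightarrow> 'w) \<Rightarrow> 'w ptree \<Rightarrow> 'w ptree \<Rightarrow> ('w ptree \<Rightarrow>\<^sub>0 'k)"
where
  "tri_lt0 add (Node x ss) T =
     (if ss = [] then basis (Node x [T])
      else graft x (butlast ss)
             (tri_lt0 add (last ss) T + tri_gt0 add (last ss) T + tri_dot0 add (last ss) T) [])"
| "tri_gt0 add S (Node y ts) =
     (case ts of [] \<Rightarrow> basis (Node y [S])
      | T1 # us \<Rightarrow> graft y [] (tri_lt0 add S T1 + tri_gt0 add S T1 + tri_dot0 add S T1) us)"
| "tri_dot0 add (Node x ss) (Node y ts) =
     (if ss = [] then basis (Node (add x y) ts)
      else case ts of [] \<Rightarrow> basis (Node (add x y) ss)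
      | T1 # us \<Rightarrow> graft (add x y) (butlast ss)
             (tri_lt0 add (last ss) T1 + tri_gt0 add (last ss) T1 + tri_dot0 add (last ss) T1) us)"
  by pat_completeness auto
termination
  by (relation "measure (case_sum (\<lambda>(a, S, T). size S + size T)
        (case_sum (\<lambda>(a, S, T). size S + size T) (\<lambda>(a, S, T). size S + size T)))")
     (auto dest: size_last_less)

definition tri_lt ::
  "('w \<Rightarrow> 'w \<Rightarrow> 'w) \<Rightarrow> ('w ptree \<Rightarrow>\<^sub>0 'k::field) \<Rightarrow> ('w ptree \<Rightarrow>\<^sub>0 'k) \<Rightarrow> ('w ptree \<Rightarrow>\<^sub>0 'k)" where
  "tri_lt add = bilin_ext (tri_lt0 add)"

definition tri_gt ::
  "('w \<Rightarrow> 'w \<Rightarrow> 'w) \<Rightarrow> ('w ptree \<Rightarrow>\<^sub>0 'k::field) \<Rightarrow> ('w ptree \<Rightarrow>\<^sub>0 'k) \<Rightarrow> ('w ptree \<Rightarrow>\<^sub>0 'k)" where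
  "tri_gt add = bilin_ext (tri_gt0 add)"

definition tri_dot ::
  "('w \<Rightarrow> 'w \<Rightarrow> 'w) \<Rightarrow> ('w ptree \<Rightarrow>\<^sub>0 'k::field) \<Rightarrow> ('w ptree \<Rightarrow>\<^sub>0 'k) \<Rightarrow> ('w ptree \<Rightarrow>\<^sub>0 'k)" where
  "tri_dot add = bilin_ext (tri_dot0 add)"

text \<open>A node of a branch is represented by the full subtree hanging from it.\<close>

function right_branch :: "'w ptree \<Rightarrow> 'w ptree list" where
  "right_branch (Node x ts) = Node x ts # (if ts = [] then [] else right_branch (last ts))"
  by pat_completeness auto
termination
  by (relation "measure size") (auto simp: size_last_less)

fun left_branch :: "'w ptree \<Rightarrow> 'w ptree list" where
  "left_branch (Node x []) = [Node x []]"
| "left_branch (Node x (u # us)) = Node x (u # us) # left_branch u"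

text \<open>
  Decorations and forests of the two combs, numbered consecutively from \<open>1\<close>: first the right comb
  of \<open>t\<close>, then the left comb of \<open>s\<close>. At the end of a branch both \<^term>\<open>butlast []\<close> and
  \<^term>\<open>tl []\<close> give the empty forest.
\<close>

definition comb_decor :: "'w ptree \<Rightarrow> 'w ptree \<Rightarrow> nat \<Rightarrow> 'w" where
  "comb_decor t s i =
     (let p = length (right_branch t)
      in if i \<le> p then decor (right_branch t ! (i - 1)) else decor (left_branch s ! (i - p - 1)))"

definition comb_forest :: "'w ptree \<Rightarrow> 'w ptree \<Rightarrow> nat \<Rightarrow> 'w ptree list" where
  "comb_forest t s i =
     (let p = length (right_branch t)
      in if i \<le> p then butlast (children (right_branch t ! (i - 1)))
         else tl (children (left_branch s ! (i - p - 1))))"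

text \<open>
  Maps are taken extensional (undefined outside \<open>{1..p + q}\<close>), so that each quasi-shuffle is a
  single HOL function.
\<close>

definition is_qshuffle :: "nat \<Rightarrow> nat \<Rightarrow> nat \<Rightarrow> (nat \<Rightarrow> nat) \<Rightarrow> bool" where
  "is_qshuffle p q n \<sigma> \<longleftrightarrow>
     \<sigma> \<in> extensional {1..p + q} \<and> \<sigma> ` {1..p + q} = {1..n} \<and>
     strict_mono_on {1..p} \<sigma> \<and> strict_mono_on {p + 1..p + q} \<sigma>"

definition QSh :: "nat \<Rightarrow> nat \<Rightarrow> (nat \<Rightarrow> nat) set" where
  "QSh p q = {\<sigma>. \<exists>n\<ge>1. is_qshuffle p q n \<sigma>}"

definition Sh :: "nat \<Rightarrow> nat \<Rightarrow> (nat \<Rightarrow> nat) set" where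
  "Sh p q = {\<sigma>. \<exists>n\<ge>1. is_qshuffle p q n \<sigma> \<and> bij_betw \<sigma> {1..p + q} {1..n}}"

lemma Sh_subset_QSh: "Sh p q \<subseteq> QSh p q"
  by (auto simp: Sh_def QSh_def)

lemma finite_QSh: "finite (QSh p q)"
proof (rule finite_subset)
  show "QSh p q \<subseteq> PiE {1..p + q} (\<lambda>_. {1..p + q})"
  proof
    fix \<sigma> assume "\<sigma> \<in> QSh p q"
    then obtain n where ext: "\<sigma> \<in> extensional {1..p + q}" and im: "\<sigma> ` {1..p + q} = {1..n}"
      by (auto simp: QSh_def is_qshuffle_def)
    have "n \<le> p + q"
      using card_image_le[of "{1..p + q}" \<sigma>] im by simp
    then have "\<sigma> ` {1..p + q} \<subseteq> {1..p + q}"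
      using im by simp
    then show "\<sigma> \<in> PiE {1..p + q} (\<lambda>_. {1..p + q})"
      using ext by (simp add: PiE_iff image_subset_iff)
  qed
qed (simp add: finite_PiE)

lemma finite_Sh: "finite (Sh p q)"
  using finite_subset[OF Sh_subset_QSh finite_QSh] .

text \<open>
  \<open>ladder_from d L R j m\<close> is the ladder with nodes \<open>j, \<dots>, j + m\<close>, where node \<open>i\<close> is decorated by
  \<open>d i\<close> and carries the forest \<open>L i\<close> to the left and \<open>R i\<close> to the right of the ladder.
\<close>

fun ladder_from ::
  "(nat \<Rightarrow> 'w) \<Rightarrow> (nat \<Rightarrow> 'w ptree list) \<Rightarrow> (nat \<Rightarrow> 'w ptree list) \<Rightarrow> nat \<Rightarrow> nat \<Rightarrow> 'w ptree" where
  "ladder_from d L R j 0 = Node (d j) (L j @ R j)"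
| "ladder_from d L R j (Suc m) = Node (d j) (L j @ ladder_from d L R (Suc j) m # R j)"

text \<open>
  \<open>p + q\<close> is the total number of nodes on the two branches, and the ladder has \<open>n\<close> nodes, where
  \<open>{1..n}\<close> is the image of \<open>\<sigma>\<close>. The concatenations below have at most one term, by injectivity of
  \<open>\<sigma>\<close> on each block. The argument \<open>d\<close> computes the decoration of a node from its preimage.
\<close>

definition comb_tree ::
  "(nat set \<Rightarrow> 'w) \<Rightarrow> (nat \<Rightarrow> nat) \<Rightarrow> 'w ptree \<Rightarrow> 'w ptree \<Rightarrow> 'w ptree" where
  "comb_tree d \<sigma> t s =
     (let p = length (right_branch t); q = length (left_branch s);
          n = card (\<sigma> ` {1..p + q})
      in ladder_from
           (\<lambda>j. d {i \<in> {1..p + q}. \<sigma> i = j})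
           (\<lambda>j. concat (map (comb_forest t s) (filter (\<lambda>i. \<sigma> i = j) [1..<p + 1])))
           (\<lambda>j. concat (map (comb_forest t s) (filter (\<lambda>i. \<sigma> i = j) [p + 1..<p + q + 1])))
           1 (n - 1))"

definition shuffle_tree :: "(nat \<Rightarrow> nat) \<Rightarrow> 'w ptree \<Rightarrow> 'w ptree \<Rightarrow> 'w ptree" where
  "shuffle_tree \<sigma> t s = comb_tree (\<lambda>A. comb_decor t s (the_elem A)) \<sigma> t s"

text \<open>
  A preimage with two elements is \<open>{i, r}\<close> with \<open>i\<close> in the first and \<open>r\<close> in the second block; hence
  \<open>i\<close> is its minimum and \<open>r\<close> its maximum.
\<close>

definition qshuffle_tree ::
  "('w \<Rightarrow> 'w \<Rightarrow> 'w) \<Rightarrow> (nat \<Rightarrow> nat) \<Rightarrow> 'w ptree \<Rightarrow> 'w ptree \<Rightarrow> 'w ptree" where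
  "qshuffle_tree add \<sigma> t s =
     comb_tree
       (\<lambda>A. if is_singleton A then comb_decor t s (the_elem A)
             else add (comb_decor t s (Min A)) (comb_decor t s (Max A))) \<sigma> t s"

end

theory Submission
  imports Defs
begin

text \<open>
  A quasi-shuffle is determined by the preimage \<open>C\<close> of its least value and by the quasi-shuffle
  of the remaining labels; \<open>C\<close> consists of the first label of one or of both blocks. Cutting
  the ladder below its root therefore gives the sums over quasi-shuffles the same recursion as the
  products, the three possibilities for \<open>C\<close> matching the three products. Once one block is used
  up, a single map is left, and its tree is the rest of the other comb with nothing added.
\<close>

section \<open>Additivity of linear extensions and of grafting\<close>

lemma lin_ext_superset:
  fixes f :: "'a \<Rightarrow> ('b \<Rightarrow>\<^sub>0 'k::field)"
  assumes "finite K" "Poly_Mapping.keys v \<subseteq> K"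
  shows "lin_ext f v = (\<Sum>a\<in>K. scale (Poly_Mapping.lookup v a) (f a))"
  unfolding lin_ext_def
proof (rule sum.mono_neutral_left[OF assms])
  have "scale 0 u = 0" for u :: "'b \<Rightarrow>\<^sub>0 'k"
    by (rule poly_mapping_eqI) (simp add: scale_def Poly_Mapping.map.rep_eq)
  then show "\<forall>a\<in>K - Poly_Mapping.keys v. scale (Poly_Mapping.lookup v a) (f a) = 0"
    by (simp add: in_keys_iff)
qed

lemma lin_ext_add:
  fixes f :: "'a \<Rightarrow> ('b \<Rightarrow>\<^sub>0 'k::field)"
  shows "lin_ext f (u + v) = lin_ext f u + lin_ext f v"
proof -
  \<comment> \<open>Cancellation may shrink the support of \<open>u + v\<close>, so all three sums
    are taken over the union of the two supports.\<close>
  let ?K = "Poly_Mapping.keys u \<union> Poly_Mapping.keys v"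
  have "scale (c + d) w = scale c w + scale d w" for c d and w :: "'b \<Rightarrow>\<^sub>0 'k"
    by (rule poly_mapping_eqI) (simp add: scale_def Poly_Mapping.map.rep_eq lookup_add when_def algebra_simps)
  then show ?thesis
    using lin_ext_superset[of ?K "u + v" f] lin_ext_superset[of ?K u f]
      lin_ext_superset[of ?K v f] Poly_Mapping.keys_add[of u v]
    by (simp add: lookup_add sum.distrib)
qed

lemma lin_ext_zero: "lin_ext f 0 = 0"
  by (simp add: lin_ext_def)

lemma lin_ext_sum: "lin_ext f (\<Sum>i\<in>I. v i) = (\<Sum>i\<in>I. lin_ext f (v i))"
  by (induction I rule: infinite_finite_induct) (simp_all add: lin_ext_zero lin_ext_add)

lemma graft_basis [simp]: "graft x ls (basis u) rs = basis (Node x (ls @ u # rs))"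
  by (simp add: graft_def)

lemma graft_sum: "graft x ls (\<Sum>i\<in>I. v i) rs = (\<Sum>i\<in>I. graft x ls (v i) rs)"
  by (simp add: graft_def lin_ext_sum)

section \<open>Maps with consecutive values on two blocks, and removal of the least value\<close>

text \<open>
  The blocks keep their labels when the ladder is cut below its root, so no renumbering is needed:
  only the sets \<open>A\<close>, \<open>B\<close> and the least value \<open>j\<close> change. The flag \<open>e\<close> selects the shuffles.
\<close>

definition quasi :: "bool \<Rightarrow> nat set \<Rightarrow> nat set \<Rightarrow> nat \<Rightarrow> (nat \<Rightarrow> nat) \<Rightarrow> bool" where
  "quasi e A B j \<sigma> \<longleftrightarrow>
     \<sigma> \<in> extensional (A \<union> B) \<and> (\<exists>n. \<sigma> ` (A \<union> B) = {j..<n}) \<and>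
     strict_mono_on A \<sigma> \<and> strict_mono_on B \<sigma> \<and> (e \<longrightarrow> inj_on \<sigma> (A \<union> B))"

definition level :: "nat set \<Rightarrow> nat \<Rightarrow> (nat \<Rightarrow> nat) \<Rightarrow> nat set" where
  "level X j \<sigma> = {i \<in> X. \<sigma> i = j}"

text \<open>Puts a root with labels \<open>C\<close> below the ladder of \<open>\<tau>\<close>. It
  is meant for maps whose values start at \<open>Suc j\<close> already, so nothing is
  shifted.\<close>

definition extend :: "nat set \<Rightarrow> nat \<Rightarrow> (nat \<Rightarrow> nat) \<Rightarrow> nat \<Rightarrow> nat" where
  "extend C j \<tau> = (\<lambda>i. if i \<in> C then j else \<tau> i)"

lemma quasi_ge:
  assumes "quasi e A B j \<sigma>" "x \<in> A \<union> B"
  shows "j \<le> \<sigma> x"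
proof -
  obtain n where "\<sigma> ` (A \<union> B) = {j..<n}"
    using assms(1) by (auto simp: quasi_def)
  with assms(2) have "\<sigma> x \<in> {j..<n}" by blast
  then show ?thesis by simp
qed

lemma quasi_restrict:
  assumes "quasi e A B j \<sigma>" "level (A \<union> B) j \<sigma> = C"
  shows "quasi e (A - C) (B - C) (Suc j) (restrict \<sigma> (A \<union> B - C))"
proof -
  obtain n where n: "\<sigma> ` (A \<union> B) = {j..<n}"
    using assms(1) by (auto simp: quasi_def)
  have "\<sigma> ` (A \<union> B - C) = \<sigma> ` (A \<union> B) - {j}"
    using assms(2) by (auto simp: level_def)
  also have "\<dots> = {Suc j..<n}"
    unfolding n by auto
  finally have "\<sigma> ` (A \<union> B - C) = {Suc j..<n}" .
  moreover have "A - C \<union> (B - C) = A \<union> B - C" by blast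
  ultimately show ?thesis
    using assms(1)
    by (auto simp: quasi_def inj_on_def strict_mono_on_def)
qed

text \<open>The value \<open>j\<close> lies below all values of \<open>\<tau>\<close>, so
  monotonicity survives if \<open>C\<close> meets each block at most in its least label
  (\<open>minA\<close>, \<open>minB\<close>). In the injective case only one label may take the
  value \<open>j\<close>.\<close>

lemma quasi_extend:
  assumes \<tau>: "quasi e (A - C) (B - C) (Suc j) \<tau>"
    and C: "C \<subseteq> A \<union> B" "C \<noteq> {}"
    and minA: "\<And>c x. c \<in> C \<Longrightarrow> c \<in> A \<Longrightarrow> x \<in> A \<Longrightarrow> c \<le> x"
    and minB: "\<And>c x. c \<in> C \<Longrightarrow> c \<in> B \<Longrightarrow> x \<in> B \<Longrightarrow> c \<le> x"
    and e: "e \<Longrightarrow> is_singleton C"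
  shows "quasi e A B j (extend C j \<tau>)"
proof -
  have un: "A - C \<union> (B - C) = A \<union> B - C" by blast
  have ge: "j < \<tau> x" if "x \<in> A \<union> B" "x \<notin> C" for x
    using quasi_ge[OF \<tau>, of x] that by auto
  obtain n where n: "\<tau> ` (A \<union> B - C) = {Suc j..<n}"
    using \<tau> un by (auto simp: quasi_def)
  have "extend C j \<tau> ` (A \<union> B) = insert j (\<tau> ` (A \<union> B - C))"
    using C by (auto simp: extend_def image_iff)
  \<comment> \<open>If \<open>C\<close> exhausts both blocks, \<open>\<tau>\<close> has empty image
    and \<open>n\<close> can be any number up to \<open>Suc j\<close>; the maximum covers this
    case.\<close>
  also have "\<dots> = {j..<max n (Suc j)}"
    unfolding n by auto
  finally have img: "extend C j \<tau> ` (A \<union> B) = {j..<max n (Suc j)}" .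
  have mono: "strict_mono_on X (extend C j \<tau>)"
    if X: "X \<subseteq> A \<union> B" "strict_mono_on (X - C) \<tau>"
      "\<And>c x. c \<in> C \<Longrightarrow> c \<in> X \<Longrightarrow> x \<in> X \<Longrightarrow> c \<le> x" for X
  proof (rule strict_mono_onI)
    fix x y assume xy: "x \<in> X" "y \<in> X" "x < y"
    then have "y \<notin> C" using X(3)[of y x] by auto
    moreover have "\<tau> x < \<tau> y" if "x \<notin> C"
      using strict_mono_onD[OF X(2)] xy that \<open>y \<notin> C\<close> by blast
    ultimately show "extend C j \<tau> x < extend C j \<tau> y"
      using ge[of y] xy X(1) by (auto simp: extend_def)
  qed
  have "inj_on (extend C j \<tau>) (A \<union> B)" if e
  proof (rule inj_onI)
    fix x y assume xy: "x \<in> A \<union> B" "y \<in> A \<union> B" "extend C j \<tau> x = extend C j \<tau> y"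
    have "inj_on \<tau> (A \<union> B - C)" using \<tau> that un by (auto simp: quasi_def)
    then have "x \<notin> C \<Longrightarrow> y \<notin> C \<Longrightarrow> x = y"
      using xy by (auto simp: extend_def inj_on_def)
    moreover have "x \<in> C \<Longrightarrow> y \<in> C \<Longrightarrow> x = y"
      using e[OF that] by (auto simp: is_singleton_def)
    moreover have "x \<in> C \<longleftrightarrow> y \<in> C"
      using xy ge[of x] ge[of y] by (cases "x \<in> C"; cases "y \<in> C") (simp_all add: extend_def)
    ultimately show "x = y" by blast
  qed
  moreover have "extend C j \<tau> \<in> extensional (A \<union> B)"
    using \<tau> C un by (auto simp: quasi_def extend_def extensional_def)
  moreover have "strict_mono_on A (extend C j \<tau>)"
    using \<tau> by (intro mono minA) (simp_all add: quasi_def)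
  moreover have "strict_mono_on B (extend C j \<tau>)"
    using \<tau> by (intro mono minB) (simp_all add: quasi_def)
  ultimately show ?thesis
    using img unfolding quasi_def by blast
qed

lemma level_extend:
  assumes "quasi e (A - C) (B - C) (Suc j) \<tau>" "C \<subseteq> A \<union> B"
  shows "level (A \<union> B) j (extend C j \<tau>) = C"
proof -
  have "\<tau> x \<noteq> j" if "x \<in> A \<union> B" "x \<notin> C" for x
    using quasi_ge[OF assms(1), of x] that by auto
  then show ?thesis
    using assms(2) by (auto simp: level_def extend_def)
qed

text \<open>Restriction to the labels outside \<open>C\<close> cuts off the root and is inverse to
  \<open>extend C j\<close>, since all maps are extensional.\<close>

lemma bij_betw_extend:
  assumes C: "C \<subseteq> A \<union> B" "C \<noteq> {}"
    and minA: "\<And>c x. c \<in> C \<Longrightarrow> c \<in> A \<Longrightarrow> x \<in> A \<Longrightarrow> c \<le> x"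
    and minB: "\<And>c x. c \<in> C \<Longrightarrow> c \<in> B \<Longrightarrow> x \<in> B \<Longrightarrow> c \<le> x"
    and e: "e \<Longrightarrow> is_singleton C"
  shows "bij_betw (extend C j) {\<tau>. quasi e (A - C) (B - C) (Suc j) \<tau>}
           {\<sigma>. quasi e A B j \<sigma> \<and> level (A \<union> B) j \<sigma> = C}"
proof (rule bij_betwI[where g = "\<lambda>\<sigma>. restrict \<sigma> (A \<union> B - C)"])
  show "extend C j \<in> {\<tau>. quasi e (A - C) (B - C) (Suc j) \<tau>} \<rightarrow>
          {\<sigma>. quasi e A B j \<sigma> \<and> level (A \<union> B) j \<sigma> = C}"
    using quasi_extend[OF _ C minA minB e] level_extend C(1) by blast
  show "(\<lambda>\<sigma>. restrict \<sigma> (A \<union> B - C)) \<in> {\<sigma>. quasi e A B j \<sigma> \<and> level (A \<union> B) j \<sigma> = C} \<rightarrow>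
          {\<tau>. quasi e (A - C) (B - C) (Suc j) \<tau>}"
    using quasi_restrict by blast
next
  fix \<tau> assume "\<tau> \<in> {\<tau>. quasi e (A - C) (B - C) (Suc j) \<tau>}"
  then show "restrict (extend C j \<tau>) (A \<union> B - C) = \<tau>"
    by (auto simp: quasi_def extend_def extensional_def restrict_def fun_eq_iff)
next
  fix \<sigma> assume "\<sigma> \<in> {\<sigma>. quasi e A B j \<sigma> \<and> level (A \<union> B) j \<sigma> = C}"
  then show "extend C j (restrict \<sigma> (A \<union> B - C)) = \<sigma>"
    by (auto simp: quasi_def extend_def extensional_def restrict_def fun_eq_iff level_def)
qed

text \<open>A smaller label in the same block would need a value below \<open>j\<close>.\<close>

lemma level_subset_min:
  assumes \<sigma>: "quasi e A B j \<sigma>" and X: "X = A \<or> X = B" "x \<in> X" "\<sigma> x = j"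
    and a: "a \<in> X" "\<And>y. y \<in> X \<Longrightarrow> a \<le> y"
  shows "x = a"
proof (rule ccontr)
  assume "x \<noteq> a"
  then have "a < x" using a(2)[OF X(2)] by simp
  then have "\<sigma> a < \<sigma> x"
    using \<sigma> X a(1) by (auto simp: quasi_def strict_mono_on_def)
  moreover have "j \<le> \<sigma> a"
    using quasi_ge[OF \<sigma>, of a] X(1) a(1) by auto
  ultimately show False using X(3) by simp
qed

lemma level_nonempty:
  assumes \<sigma>: "quasi e A B j \<sigma>" and "A \<union> B \<noteq> {}"
  shows "level (A \<union> B) j \<sigma> \<noteq> {}"
proof -
  obtain n where n: "\<sigma> ` (A \<union> B) = {j..<n}"
    using assms(1) by (auto simp: quasi_def)
  with assms(2) have "{j..<n} \<noteq> {}" by (metis image_is_empty)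
  then have "j \<in> \<sigma> ` (A \<union> B)" unfolding n by simp
  then show ?thesis by (auto simp: level_def)
qed

lemma quasi_empty: "{\<sigma>. quasi e {} {} j \<sigma>} = {\<lambda>_. undefined}"
  by (auto simp: quasi_def strict_mono_on_def intro: exI[of _ 0])

lemma finite_quasi:
  assumes "finite A" "finite B"
  shows "finite {\<sigma>. quasi e A B j \<sigma>}"
proof (rule finite_subset)
  show "{\<sigma>. quasi e A B j \<sigma>} \<subseteq> PiE (A \<union> B) (\<lambda>_. {j..<j + card (A \<union> B)})"
  proof
    fix \<sigma> assume "\<sigma> \<in> {\<sigma>. quasi e A B j \<sigma>}"
    then obtain n where ext: "\<sigma> \<in> extensional (A \<union> B)" and im: "\<sigma> ` (A \<union> B) = {j..<n}"
      by (auto simp: quasi_def)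
    have "n - j \<le> card (A \<union> B)"
      using card_image_le[of "A \<union> B" \<sigma>] assms im by simp
    then have "\<sigma> ` (A \<union> B) \<subseteq> {j..<j + card (A \<union> B)}"
      unfolding im by auto
    then show "\<sigma> \<in> PiE (A \<union> B) (\<lambda>_. {j..<j + card (A \<union> B)})"
      using ext by (simp add: PiE_iff image_subset_iff)
  qed
qed (use assms in \<open>simp add: finite_PiE\<close>)

section \<open>Ladder trees of these maps and their decomposition at the root\<close>

definition level_forest ::
  "(nat \<Rightarrow> 'w ptree list) \<Rightarrow> nat set \<Rightarrow> (nat \<Rightarrow> nat) \<Rightarrow> nat \<Rightarrow> 'w ptree list" where
  "level_forest F A \<sigma> j = concat (map F (filter (\<lambda>i. \<sigma> i = j) (sorted_list_of_set A)))"

text \<open>For the blocks and forests of two combs and \<open>j = 1\<close> this is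
  \<open>comb_tree\<close>. On empty blocks truncated subtraction still yields one node, so the case
  where no label remains has to be split off below.\<close>

definition mixed_tree ::
  "(nat set \<Rightarrow> 'w) \<Rightarrow> (nat \<Rightarrow> 'w ptree list) \<Rightarrow> nat set \<Rightarrow> nat set \<Rightarrow> nat \<Rightarrow> (nat \<Rightarrow> nat) \<Rightarrow> 'w ptree"
where
  "mixed_tree d F A B j \<sigma> =
     ladder_from (\<lambda>i. d (level (A \<union> B) i \<sigma>)) (level_forest F A \<sigma>) (level_forest F B \<sigma>)
       j (card (\<sigma> ` (A \<union> B)) - 1)"

text \<open>A ladder reads its data only from its first index on, so the part above the root is
  insensitive to what happens at the root.\<close>

lemma ladder_from_cong:
  assumes "\<And>i. j \<le> i \<Longrightarrow> d i = d' i \<and> L i = L' i \<and> R i = R' i"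
  shows "ladder_from d L R j m = ladder_from d' L' R' j m"
  using assms by (induction m arbitrary: j) auto

lemma level_forest_extend_gt:
  assumes "finite A" "j < i"
  shows "level_forest F A (extend C j \<tau>) i = level_forest F (A - C) \<tau> i"
proof -
  have "filter (\<lambda>x. extend C j \<tau> x = i) (sorted_list_of_set A)
      = filter (\<lambda>x. \<tau> x = i) (filter (\<lambda>x. x \<notin> C) (sorted_list_of_set A))"
    using assms(2) by (auto simp: extend_def intro: filter_cong)
  also have "filter (\<lambda>x. x \<notin> C) (sorted_list_of_set A) = sorted_list_of_set (A - C)"
    using assms(1)
    by (intro sorted_distinct_set_unique) (auto intro: sorted_wrt_filter distinct_filter)
  finally show ?thesis by (simp add: level_forest_def)
qed

text \<open>Above \<open>j\<close> the fibres and forests of \<open>extend C j \<tau>\<close> are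
  those of \<open>\<tau>\<close>; at \<open>j\<close> only \<open>C\<close> contributes. The middle
  list is empty when the root is the whole ladder.\<close>

lemma mixed_tree_extend:
  assumes \<tau>: "quasi e (A - C) (B - C) (Suc j) \<tau>"
    and fin: "finite A" "finite B" and C: "C \<subseteq> A \<union> B" "C \<noteq> {}"
  shows "mixed_tree d F A B j (extend C j \<tau>) =
    Node (d C) (concat (map F (sorted_list_of_set (A \<inter> C))) @
      (if A \<union> B = C then [] else [mixed_tree d F (A - C) (B - C) (Suc j) \<tau>]) @
      concat (map F (sorted_list_of_set (B \<inter> C))))"
proof -
  let ?\<sigma> = "extend C j \<tau>"
  have un: "A - C \<union> (B - C) = A \<union> B - C" by blast
  have ge: "j < \<tau> x" if "x \<in> A \<union> B" "x \<notin> C" for x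
    using quasi_ge[OF \<tau>, of x] that by auto
  have root: "level_forest F X ?\<sigma> j = concat (map F (sorted_list_of_set (X \<inter> C)))"
    if "X \<subseteq> A \<union> B" for X
  proof -
    have fX: "finite X" using that fin finite_subset by blast
    have "filter (\<lambda>x. ?\<sigma> x = j) (sorted_list_of_set X) = filter (\<lambda>x. x \<in> C) (sorted_list_of_set X)"
      using fX that ge by (intro filter_cong) (force simp: extend_def)+
    also have "\<dots> = sorted_list_of_set (X \<inter> C)"
      using fX by (intro sorted_distinct_set_unique) (auto intro: sorted_wrt_filter distinct_filter)
    finally show ?thesis by (simp add: level_forest_def)
  qed
  have lv: "level (A \<union> B) j ?\<sigma> = C"
    using level_extend[OF \<tau> C(1)] .
  have above: "level (A \<union> B) i ?\<sigma> = level (A - C \<union> (B - C)) i \<tau>" if "Suc j \<le> i" for i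
    using that by (auto simp: level_def extend_def)
  \<comment> \<open>The value \<open>j\<close> is new, so the ladder has exactly one node more than
    the image of \<open>\<tau>\<close> has elements.\<close>
  have "?\<sigma> ` (A \<union> B) = insert j (\<tau> ` (A \<union> B - C))"
    using C by (auto simp: extend_def image_iff)
  moreover have "j \<notin> \<tau> ` (A \<union> B - C)" using ge by auto
  ultimately have card: "card (?\<sigma> ` (A \<union> B)) - 1 = card (\<tau> ` (A \<union> B - C))"
    using fin by simp
  show ?thesis
  proof (cases "A \<union> B = C")
    case True
    then show ?thesis
      using card lv by (simp add: mixed_tree_def root[OF Un_upper1] root[OF Un_upper2])
  next
    case False
    then have "A \<union> B - C \<noteq> {}" using C by blast
    then have "0 < card (\<tau> ` (A \<union> B - C))" using fin by (simp add: card_gt_0_iff)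
    then obtain m where m: "card (\<tau> ` (A \<union> B - C)) = Suc m" by (metis gr0_conv_Suc)
    have "ladder_from (\<lambda>i. d (level (A \<union> B) i ?\<sigma>)) (level_forest F A ?\<sigma>) (level_forest F B ?\<sigma>) (Suc j) m
        = mixed_tree d F (A - C) (B - C) (Suc j) \<tau>"
      unfolding mixed_tree_def un m using above un
      by (auto intro!: ladder_from_cong simp: level_forest_extend_gt fin)
    then show ?thesis
      using False card m lv
      by (simp add: mixed_tree_def root[OF Un_upper1] root[OF Un_upper2])
  qed
qed

section \<open>Sums over all maps and over those with prescribed root labels\<close>

definition mixed_sum ::
  "bool \<Rightarrow> (nat set \<Rightarrow> 'w) \<Rightarrow> (nat \<Rightarrow> 'w ptree list) \<Rightarrow> nat set \<Rightarrow> nat set \<Rightarrow> nat \<Rightarrow> ('w ptree \<Rightarrow>\<^sub>0 'k::field)"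
where
  "mixed_sum e d F A B j = (\<Sum>\<sigma> | quasi e A B j \<sigma>. basis (mixed_tree d F A B j \<sigma>))"

text \<open>If \<open>a\<close> and \<open>b\<close> are the first labels of the blocks, the sets
  \<open>{a}\<close>, \<open>{b}\<close> and \<open>{a, b}\<close> will give the three
  products.\<close>

definition rooted_sum ::
  "bool \<Rightarrow> (nat set \<Rightarrow> 'w) \<Rightarrow> (nat \<Rightarrow> 'w ptree list) \<Rightarrow> nat set \<Rightarrow> nat set \<Rightarrow> nat \<Rightarrow> nat set
     \<Rightarrow> ('w ptree \<Rightarrow>\<^sub>0 'k::field)" where
  "rooted_sum e d F A B j C =
     (\<Sum>\<sigma> | quasi e A B j \<sigma> \<and> level (A \<union> B) j \<sigma> = C. basis (mixed_tree d F A B j \<sigma>))"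

text \<open>The root depends on \<open>C\<close> alone. After reindexing along
  \<open>extend C j\<close>, linearity of grafting moves the sum into the subtree, which is the
  shape of the recursion for the products.\<close>

lemma rooted_sum_eq:
  fixes d :: "nat set \<Rightarrow> 'w"
  assumes fin: "finite A" "finite B" and C: "C \<subseteq> A \<union> B" "C \<noteq> {}"
    and minA: "\<And>c x. c \<in> C \<Longrightarrow> c \<in> A \<Longrightarrow> x \<in> A \<Longrightarrow> c \<le> x"
    and minB: "\<And>c x. c \<in> C \<Longrightarrow> c \<in> B \<Longrightarrow> x \<in> B \<Longrightarrow> c \<le> x"
    and e: "e \<Longrightarrow> is_singleton C"
  shows "rooted_sum e d F A B j C =
    (let ls = concat (map F (sorted_list_of_set (A \<inter> C)));
         rs = concat (map F (sorted_list_of_set (B \<inter> C)))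
     in if A \<union> B = C then basis (Node (d C) (ls @ rs))
        else graft (d C) ls (mixed_sum e d F (A - C) (B - C) (Suc j)) rs :: 'w ptree \<Rightarrow>\<^sub>0 'k::field)"
proof -
  let ?ls = "concat (map F (sorted_list_of_set (A \<inter> C)))"
  let ?rs = "concat (map F (sorted_list_of_set (B \<inter> C)))"
  let ?Q = "{\<tau>. quasi e (A - C) (B - C) (Suc j) \<tau>}"
  have "rooted_sum e d F A B j C =
      (\<Sum>\<tau>\<in>?Q. basis (mixed_tree d F A B j (extend C j \<tau>)) :: 'w ptree \<Rightarrow>\<^sub>0 'k)"
    unfolding rooted_sum_def
    by (rule sum.reindex_bij_betw[OF bij_betw_extend[OF C minA minB e], symmetric])
  also have "\<dots> = (\<Sum>\<tau>\<in>?Q. basis (Node (d C) (?ls @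
      (if A \<union> B = C then [] else [mixed_tree d F (A - C) (B - C) (Suc j) \<tau>]) @ ?rs)))"
    by (intro sum.cong refl arg_cong[where f = basis] mixed_tree_extend[OF _ fin C]) simp
  finally have *: "rooted_sum e d F A B j C = \<dots>" .
  show ?thesis
  proof (cases "A \<union> B = C")
    case True
    then have "A - C = {}" "B - C = {}" by auto
    \<comment> \<open>With no label left the sum has a single term, a root without a ladder
      child.\<close>
    then have "?Q = {\<lambda>_. undefined}"
      by (simp only: quasi_empty)
    then show ?thesis using True * by simp
  next
    case False
    then show ?thesis using * by (simp add: mixed_sum_def graft_sum)
  qed
qed

section \<open>Combs as labelled blocks\<close>

text \<open>The right branch of \<open>t\<close> is numbered from \<open>a\<close> to
  \<open>p - 1\<close>. Since \<open>D\<close>, \<open>F\<close> and \<open>p\<close> are global,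
  passing to the last child only raises \<open>a\<close> to \<open>Suc a\<close>.\<close>

definition right_comb ::
  "(nat \<Rightarrow> 'w) \<Rightarrow> (nat \<Rightarrow> 'w ptree list) \<Rightarrow> nat \<Rightarrow> nat \<Rightarrow> 'w ptree \<Rightarrow> bool" where
  "right_comb D F a p t \<longleftrightarrow> p = a + length (right_branch t) \<and>
     (\<forall>i<length (right_branch t). D (a + i) = decor (right_branch t ! i) \<and>
        F (a + i) = butlast (children (right_branch t ! i)))"

definition left_comb ::
  "(nat \<Rightarrow> 'w) \<Rightarrow> (nat \<Rightarrow> 'w ptree list) \<Rightarrow> nat \<Rightarrow> nat \<Rightarrow> 'w ptree \<Rightarrow> bool" where
  "left_comb D F b m s \<longleftrightarrow> m = b + length (left_branch s) \<and>
     (\<forall>i<length (left_branch s). D (b + i) = decor (left_branch s ! i) \<and>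
        F (b + i) = tl (children (left_branch s ! i)))"

lemma right_comb_Node:
  "right_comb D F a p (Node x ss) \<longleftrightarrow> D a = x \<and> F a = butlast ss \<and>
     (if ss = [] then p = Suc a else right_comb D F (Suc a) p (last ss))"
  by (auto simp: right_comb_def All_less_Suc2)

lemma left_comb_Node:
  "left_comb D F b m (Node y ts) \<longleftrightarrow> D b = y \<and> F b = tl ts \<and>
     (case ts of [] \<Rightarrow> m = Suc b | u # us \<Rightarrow> left_comb D F (Suc b) m u)"
  by (cases ts) (auto simp: left_comb_def All_less_Suc2)

lemma right_comb_less: "right_comb D F a p t \<Longrightarrow> a < p"
  by (cases t) (simp add: right_comb_def)

lemma left_comb_less: "left_comb D F b m s \<Longrightarrow> b < m"
  by (cases s rule: left_branch.cases) (simp_all add: left_comb_def)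

section \<open>Recursion for interval blocks\<close>

lemma mixed_sum_eq_rooted_sum:
  assumes "\<And>\<sigma>. quasi e A B j \<sigma> \<Longrightarrow> level (A \<union> B) j \<sigma> = C"
  shows "mixed_sum e d F A B j = rooted_sum e d F A B j C"
  using assms by (auto simp: mixed_sum_def rooted_sum_def intro!: sum.cong)

text \<open>Only first labels can take the least value. The conditions \<open>a < p\<close> and
  \<open>b < m\<close> inside the set let one statement cover an exhausted block as well.\<close>

lemma level_interval:
  assumes "quasi e {a..<p} {b..<m} j \<sigma>" "a < p \<or> b < m"
  shows "level ({a..<p} \<union> {b..<m}) j \<sigma> \<noteq> {}"
    and "level ({a..<p} \<union> {b..<m}) j \<sigma> \<subseteq> {x. x = a \<and> a < p \<or> x = b \<and> b < m}"
proof -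
  show "level ({a..<p} \<union> {b..<m}) j \<sigma> \<noteq> {}"
    using assms by (intro level_nonempty) auto
  show "level ({a..<p} \<union> {b..<m}) j \<sigma> \<subseteq> {x. x = a \<and> a < p \<or> x = b \<and> b < m}"
  proof
    fix x assume "x \<in> level ({a..<p} \<union> {b..<m}) j \<sigma>"
    then consider "x \<in> {a..<p}" "\<sigma> x = j" | "x \<in> {b..<m}" "\<sigma> x = j"
      by (auto simp: level_def)
    then show "x \<in> {x. x = a \<and> a < p \<or> x = b \<and> b < m}"
    proof cases
      case 1
      then show ?thesis
        using level_subset_min[OF assms(1), of "{a..<p}" x a] by simp
    next
      case 2
      then show ?thesis
        using level_subset_min[OF assms(1), of "{b..<m}" x b] by simp
    qed
  qed
qed

lemma mixed_sum_right_block: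
  assumes "b < m" "p \<le> a"
  shows "mixed_sum e d F {a..<p} {b..<m} j = rooted_sum e d F {a..<p} {b..<m} j {b}"
proof (rule mixed_sum_eq_rooted_sum)
  fix \<sigma> assume "quasi e {a..<p} {b..<m} j \<sigma>"
  from level_interval[OF this] assms
  show "level ({a..<p} \<union> {b..<m}) j \<sigma> = {b}" by auto
qed

lemma mixed_sum_left_block:
  assumes "a < p" "m \<le> b"
  shows "mixed_sum e d F {a..<p} {b..<m} j = rooted_sum e d F {a..<p} {b..<m} j {a}"
proof (rule mixed_sum_eq_rooted_sum)
  fix \<sigma> assume "quasi e {a..<p} {b..<m} j \<sigma>"
  from level_interval[OF this] assms
  show "level ({a..<p} \<union> {b..<m}) j \<sigma> = {a}" by auto
qed

text \<open>The bound \<open>p \<le> b\<close> separates the blocks, so removing \<open>a\<close>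
  shortens the first and leaves the second intact.\<close>

lemma rooted_sum_left:
  assumes "a < p" "p \<le> b"
  shows "rooted_sum e d F {a..<p} {b..<m} j {a} =
    (if p = Suc a \<and> m \<le> b then basis (Node (d {a}) (F a))
     else graft (d {a}) (F a) (mixed_sum e d F {Suc a..<p} {b..<m} (Suc j)) [])"
proof -
  have sets: "{a..<p} \<inter> {a} = {a}" "{b..<m} \<inter> {a} = {}"
    "{a..<p} - {a} = {Suc a..<p}" "{b..<m} - {a} = {b..<m}"
    using assms by auto
  have eq: "({a..<p} \<union> {b..<m} = {a}) = (p = Suc a \<and> m \<le> b)"
  proof
    assume "{a..<p} \<union> {b..<m} = {a}"
    then have "x \<in> {a..<p} \<or> x \<in> {b..<m} \<longleftrightarrow> x \<in> {a}" for x by blast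
    \<comment> \<open>\<open>Suc a\<close> lies in the first block unless \<open>p = Suc a\<close>,
      and \<open>b\<close> in the second unless that is empty; neither equals
      \<open>a\<close>.\<close>
    from this[of "Suc a"] this[of "b"] show "p = Suc a \<and> m \<le> b" using assms by auto
  qed auto
  show ?thesis
    by (rule trans[OF rooted_sum_eq]) (use assms in \<open>auto simp: sets eq\<close>)
qed

lemma rooted_sum_right:
  assumes "b < m" "p \<le> b"
  shows "rooted_sum e d F {a..<p} {b..<m} j {b} =
    (if p \<le> a \<and> m = Suc b then basis (Node (d {b}) (F b))
     else graft (d {b}) [] (mixed_sum e d F {a..<p} {Suc b..<m} (Suc j)) (F b))"
proof -
  have sets: "{a..<p} \<inter> {b} = {}" "{b..<m} \<inter> {b} = {b}"
    "{a..<p} - {b} = {a..<p}" "{b..<m} - {b} = {Suc b..<m}"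
    using assms by auto
  have eq: "({a..<p} \<union> {b..<m} = {b}) = (p \<le> a \<and> m = Suc b)"
  proof
    assume "{a..<p} \<union> {b..<m} = {b}"
    then have "x \<in> {a..<p} \<or> x \<in> {b..<m} \<longleftrightarrow> x \<in> {b}" for x by blast
    from this[of "Suc b"] this[of "a"] show "p \<le> a \<and> m = Suc b" using assms by auto
  qed auto
  show ?thesis
    by (rule trans[OF rooted_sum_eq]) (use assms in \<open>auto simp: sets eq\<close>)
qed

text \<open>Two labels can share the root only without injectivity, hence the flag
  \<open>False\<close>.\<close>

lemma rooted_sum_both:
  assumes "a < p" "b < m" "p \<le> b"
  shows "rooted_sum False d F {a..<p} {b..<m} j {a, b} =
    (if p = Suc a \<and> m = Suc b then basis (Node (d {a, b}) (F a @ F b))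
     else graft (d {a, b}) (F a) (mixed_sum False d F {Suc a..<p} {Suc b..<m} (Suc j)) (F b))"
proof -
  have sets: "{a..<p} \<inter> {a, b} = {a}" "{b..<m} \<inter> {a, b} = {b}"
    "{a..<p} - {a, b} = {Suc a..<p}" "{b..<m} - {a, b} = {Suc b..<m}"
    using assms by auto
  have eq: "({a..<p} \<union> {b..<m} = {a, b}) = (p = Suc a \<and> m = Suc b)"
  proof
    assume "{a..<p} \<union> {b..<m} = {a, b}"
    then have "x \<in> {a..<p} \<or> x \<in> {b..<m} \<longleftrightarrow> x \<in> {a, b}" for x by blast
    from this[of "Suc a"] this[of "Suc b"] show "p = Suc a \<and> m = Suc b" using assms by auto
  qed (use assms in auto)
  show ?thesis
    by (rule trans[OF rooted_sum_eq]) (use assms in \<open>auto simp: sets eq\<close>)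
qed

text \<open>With one block left every root is forced, and the ladder with its forests rebuilds
  \<open>s\<close> along its left branch.\<close>

lemma mixed_sum_left_empty:
  assumes "\<And>i. d {i} = D i" "left_comb D F b m s" "p \<le> a" "p \<le> b"
  shows "mixed_sum e d F {a..<p} {b..<m} j = (basis s :: 'w ptree \<Rightarrow>\<^sub>0 'k::field)"
  using assms(2,4)
proof (induction s arbitrary: b j rule: left_branch.induct)
  case (1 x)
  note less = left_comb_less[OF 1(1)]
  show ?case
    
    unfolding mixed_sum_right_block[OF less assms(3)] rooted_sum_right[OF less 1(2)]
    using 1 assms(3) by (simp add: left_comb_Node assms(1))
next
  case (2 x u us)
  note less = left_comb_less[OF 2(2)]
  have u: "left_comb D F (Suc b) m u" using 2(2) by (simp add: left_comb_Node)
  show ?case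
    unfolding mixed_sum_right_block[OF less assms(3)] rooted_sum_right[OF less 2(3)]
    using 2(2,3) 2(1)[OF u] left_comb_less[OF u] by (simp add: left_comb_Node assms(1))
qed

text \<open>The mirror image: the descent follows last children, and \<open>butlast ts\<close> with
  \<open>last ts\<close> gives back \<open>ts\<close>.\<close>

lemma mixed_sum_right_empty:
  assumes "\<And>i. d {i} = D i" "right_comb D F a p t" "m \<le> b" "p \<le> b"
  shows "mixed_sum e d F {a..<p} {b..<m} j = (basis t :: 'w ptree \<Rightarrow>\<^sub>0 'k::field)"
  using assms(2)
proof (induction t arbitrary: a j rule: right_branch.induct)
  case (1 x ts)
  note less = right_comb_less[OF 1(2)]
  note eq = mixed_sum_left_block[OF less assms(3)] rooted_sum_left[OF less assms(4)]
  show ?case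
  proof (cases "ts = []")
    case True
    then show ?thesis
      unfolding eq using 1(2) assms(3) by (simp add: right_comb_Node assms(1))
  next
    case False
    then have t: "right_comb D F (Suc a) p (last ts)" using 1(2) by (simp add: right_comb_Node)
    show ?thesis
      unfolding eq using False 1(2) 1(1)[OF False t] right_comb_less[OF t]
      by (simp add: right_comb_Node assms(1))
  qed
qed

text \<open>The root carries \<open>a\<close>, \<open>b\<close> or both, and injectivity excludes
  the last case. The three summands mirror the decomposition of the total product.\<close>

lemma mixed_sum_split:
  fixes d :: "nat set \<Rightarrow> 'a"
  assumes "a < p" "b < m" "p \<le> b"
  shows "mixed_sum e d F {a..<p} {b..<m} j =
    rooted_sum e d F {a..<p} {b..<m} j {a} + rooted_sum e d F {a..<p} {b..<m} j {b} +
    (if e then 0 else rooted_sum e d F {a..<p} {b..<m} j {a, b} :: 'a ptree \<Rightarrow>\<^sub>0 'b::field)"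
proof -
  let ?A = "{a..<p}" and ?B = "{b..<m}"
  let ?R = "\<lambda>C. {\<sigma>. quasi e ?A ?B j \<sigma> \<and> level (?A \<union> ?B) j \<sigma> = C}"
  have fin: "finite (?R C)" for C
    by (rule finite_subset[OF _ finite_quasi[of ?A ?B e j]]) auto
  have "level (?A \<union> ?B) j \<sigma> \<in> {{a}, {b}, {a, b}}" if "quasi e ?A ?B j \<sigma>" for \<sigma>
  proof -
    have "a < p \<or> b < m" using assms by simp
    note level_interval[OF that this]
    then have "level (?A \<union> ?B) j \<sigma> \<noteq> {}" "level (?A \<union> ?B) j \<sigma> \<subseteq> {a, b}"
      by blast+
    then show ?thesis by blast
  qed
  then have cover: "{\<sigma>. quasi e ?A ?B j \<sigma>} = ?R {a} \<union> ?R {b} \<union> ?R {a, b}"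
    by blast
  have ab: "a \<noteq> b" using assms by simp
  then have disj: "?R {a} \<inter> ?R {b} = {}" "(?R {a} \<union> ?R {b}) \<inter> ?R {a, b} = {}"
    by auto
  have "?R {a, b} = {}" if e
  proof -
    have False if "quasi e ?A ?B j \<sigma>" "level (?A \<union> ?B) j \<sigma> = {a, b}" for \<sigma>
    proof -
      have "a \<in> level (?A \<union> ?B) j \<sigma>" "b \<in> level (?A \<union> ?B) j \<sigma>" using that by blast+
      then have "a \<in> ?A \<union> ?B" "b \<in> ?A \<union> ?B" "\<sigma> a = \<sigma> b" by (simp_all add: level_def)
      moreover have "inj_on \<sigma> (?A \<union> ?B)" using that(1) \<open>e\<close> by (simp add: quasi_def)
      ultimately show False using ab by (blast dest: inj_onD)
    qed
    then show ?thesis by blast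
  qed
  then have "rooted_sum e d F ?A ?B j {a, b} = (0 :: 'a ptree \<Rightarrow>\<^sub>0 'b)" if e
    using that by (simp only: rooted_sum_def sum.empty)
  then show ?thesis
    unfolding mixed_sum_def cover sum.union_disjoint[OF finite_UnI[OF fin fin] fin disj(2)]
      sum.union_disjoint[OF fin fin disj(1)] rooted_sum_def[symmetric]
    by simp
qed

section \<open>Comparison with the products\<close>

text \<open>
  Both theories at once: in the dendriform case (\<open>e\<close> true) the third product \<open>dt\<close> vanishes.
\<close>

lemma products_eq_rooted_sums:
  fixes lt gt dt :: "'w ptree \<Rightarrow> 'w ptree \<Rightarrow> ('w ptree \<Rightarrow>\<^sub>0 'k::field)"
  assumes lt: "\<And>x ss T. lt (Node x ss) T =
      (if ss = [] then basis (Node x [T])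
       else graft x (butlast ss) (lt (last ss) T + gt (last ss) T + dt (last ss) T) [])"
    and gt: "\<And>S y ts. gt S (Node y ts) =
      (case ts of [] \<Rightarrow> basis (Node y [S])
       | u # us \<Rightarrow> graft y [] (lt S u + gt S u + dt S u) us)"
    and dt: "\<And>x ss y ts. dt (Node x ss) (Node y ts) =
      (if e then 0 else if ss = [] then basis (Node (add x y) ts)
       else case ts of [] \<Rightarrow> basis (Node (add x y) ss)
       | u # us \<Rightarrow> graft (add x y) (butlast ss) (lt (last ss) u + gt (last ss) u + dt (last ss) u) us)"
    and d: "\<And>i. d {i} = D i"
    and d2: "\<And>i r. \<not> e \<Longrightarrow> i < r \<Longrightarrow> d {i, r} = add (D i) (D r)"
    and "right_comb D F a p t" "left_comb D F b m s" "p \<le> b"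
  shows "lt t s = rooted_sum e d F {a..<p} {b..<m} j {a} \<and>
    gt t s = rooted_sum e d F {a..<p} {b..<m} j {b} \<and>
    (\<not> e \<longrightarrow> dt t s = rooted_sum e d F {a..<p} {b..<m} j {a, b})"
  using assms(6-)
proof (induction "size t + size s" arbitrary: t s a b j rule: less_induct)
  case less
  \<comment> \<open>The induction hypotheses for the three products combine: on smaller trees the
    total product is the sum without condition on the root. If \<open>e\<close> holds,
    \<open>dt\<close> vanishes like the third summand of \<open>mixed_sum_split\<close>.\<close>
  have star: "lt t' s' + gt t' s' + dt t' s' = mixed_sum e d F {a'..<p} {b'..<m} j'"
    if "size t' + size s' < size t + size s"
      and comb: "right_comb D F a' p t'" "left_comb D F b' m s'" "p \<le> b'" for t' s' a' b' j'
  proof -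
    have "e \<Longrightarrow> dt t' s' = 0" by (cases t'; cases s') (simp add: dt)
    then show ?thesis
      unfolding mixed_sum_split[OF comb(1)[THEN right_comb_less] comb(2)[THEN left_comb_less] comb(3)]
      using less(1)[OF that, of j'] by (cases e) simp_all
  qed
  obtain x ss where t: "t = Node x ss" by (cases t)
  obtain y ts where s: "s = Node y ts" by (cases s)
  note tc = less(2)[unfolded t right_comb_Node] and sc = less(3)[unfolded s left_comb_Node]
  note ap = right_comb_less[OF less(2)] and bm = left_comb_less[OF less(3)]
  have size_ss: "size (last ss) < size t" if "ss \<noteq> []"
    using size_last_less[OF that] by (simp add: t)
  have "lt t s = rooted_sum e d F {a..<p} {b..<m} j {a}"
  proof (cases "ss = []")
    case True
    \<comment> \<open>The root \<open>a\<close> uses up the right branch of \<open>t\<close>, so all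
      of \<open>s\<close> hangs above it.\<close>
    then have "mixed_sum e d F {Suc a..<p} {b..<m} (Suc j) = (basis s :: 'w ptree \<Rightarrow>\<^sub>0 'k)"
      using tc less(4) by (intro mixed_sum_left_empty[OF d less(3)]) auto
    then show ?thesis
      unfolding rooted_sum_left[OF ap less(4)]
      using True tc bm less(4) by (simp add: d lt[of x ss s, folded t])
  next
    case False
    then have r: "right_comb D F (Suc a) p (last ss)" using tc by simp
    have "size (last ss) + size s < size t + size s" using size_ss[OF False] by simp
    from star[OF this r less(3,4), of "Suc j"] show ?thesis
      unfolding rooted_sum_left[OF ap less(4)]
      using False tc right_comb_less[OF r] by (simp add: d lt[of x ss s, folded t])
  qed
  moreover have "gt t s = rooted_sum e d F {a..<p} {b..<m} j {b}"
  proof (cases ts)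
    case Nil
    then have "mixed_sum e d F {a..<p} {Suc b..<m} (Suc j) = (basis t :: 'w ptree \<Rightarrow>\<^sub>0 'k)"
      using sc less(4) by (intro mixed_sum_right_empty[OF d less(2)]) auto
    then show ?thesis
      unfolding rooted_sum_right[OF bm less(4)]
      using Nil sc ap by (simp add: d gt[of t y ts, folded s])
  next
    case (Cons u us)
    then have u: "left_comb D F (Suc b) m u" using sc by simp
    have "size t + size u < size t + size s" using Cons by (simp add: s)
    from star[OF this less(2) u, of "Suc j"] show ?thesis
      unfolding rooted_sum_right[OF bm less(4)]
      using Cons sc less(4) left_comb_less[OF u] by (simp add: d gt[of t y ts, folded s])
  qed
  moreover have "dt t s = rooted_sum e d F {a..<p} {b..<m} j {a, b}" if "\<not> e"
  proof -
    have e: "e = False" using that by simp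
    \<comment> \<open>From \<open>a < p\<close> and \<open>p \<le> b\<close> comes the order that
      \<open>d2\<close> asks for; the decoration from \<open>t\<close> stands first.\<close>
    have dab: "d {a, b} = add x y" using d2[OF that, of a b] tc sc ap less(4) by simp
    note both = rooted_sum_both[OF ap bm less(4), of d F j, folded e, unfolded dab]
    note dt' = dt[of x ss y ts, folded t s, simplified e if_False]
    show ?thesis
    proof (cases "ss = []")
      case True
      show ?thesis
      proof (cases ts)
        case Nil
        then show ?thesis unfolding both dt' using True tc sc by simp
      next
        case (Cons u us)
        then have u: "left_comb D F (Suc b) m u" using sc by simp
        \<comment> \<open>The common root exhausts the first block; what remains is the comb of the
          first child of \<open>s\<close>.\<close>
        have "mixed_sum e d F {Suc a..<p} {Suc b..<m} (Suc j) = (basis u :: 'w ptree \<Rightarrow>\<^sub>0 'k)"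
          using True tc less(4) by (intro mixed_sum_left_empty[OF d u]) auto
        then show ?thesis
          unfolding both dt' using True Cons tc sc left_comb_less[OF u] by simp
      qed
    next
      case False
      then have r: "right_comb D F (Suc a) p (last ss)" using tc by simp
      show ?thesis
      proof (cases ts)
        case Nil
        \<comment> \<open>Now the second block is exhausted: \<open>last ss\<close> returns
          unchanged behind \<open>butlast ss\<close>, so the root carries all of
          \<open>ss\<close>.\<close>
        then have "mixed_sum e d F {Suc a..<p} {Suc b..<m} (Suc j) = (basis (last ss) :: 'w ptree \<Rightarrow>\<^sub>0 'k)"
          using sc less(4) by (intro mixed_sum_right_empty[OF d r]) auto
        then show ?thesis
          unfolding both dt' using False Nil tc sc right_comb_less[OF r] by simp
      next
        case (Cons u us)
        then have u: "left_comb D F (Suc b) m u" using sc by simp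
        have "size (last ss) + size u < size t + size s"
          using size_ss[OF False] Cons by (simp add: s)
        from star[OF this r u, of "Suc j"] show ?thesis
          unfolding both dt' using False Cons tc sc right_comb_less[OF r] left_comb_less[OF u] less(4) by simp
      qed
    qed
  qed
  ultimately show ?case by blast
qed

section \<open>Return to shuffles and quasi-shuffles of two combs\<close>

text \<open>A half-open image may be empty, while \<open>n \<ge> 1\<close> forbids this;
  \<open>0 < p + q\<close> removes the difference.\<close>

lemma quasi_iff_is_qshuffle:
  assumes "0 < p + q"
  shows "quasi e {1..<p + 1} {p + 1..<p + q + 1} 1 \<sigma> \<longleftrightarrow>
    (\<exists>n\<ge>1. is_qshuffle p q n \<sigma> \<and> (e \<longrightarrow> bij_betw \<sigma> {1..p + q} {1..n}))"
proof -
  have un: "{1..<p + 1} \<union> {p + 1..<p + q + 1} = {1..p + q}" by auto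
  have "(\<exists>n. \<sigma> ` {1..p + q} = {1..<n}) \<longleftrightarrow> (\<exists>n\<ge>1. \<sigma> ` {1..p + q} = {1..n})"
  proof
    assume "\<exists>n. \<sigma> ` {1..p + q} = {1..<n}"
    then obtain n where n: "\<sigma> ` {1..p + q} = {1..<n}" ..
    have "1 \<le> p + q" using assms by linarith
    \<comment> \<open>Label \<open>1\<close> shows that the image is not empty, so that
      \<open>n - 1\<close> is an admissible closed bound.\<close>
    then have "\<sigma> 1 \<in> \<sigma> ` {1..p + q}" by (intro imageI) simp
    then have "2 \<le> n" unfolding n by auto
    then show "\<exists>n\<ge>1. \<sigma> ` {1..p + q} = {1..n}"
      using n by (intro exI[of _ "n - 1"]) auto
  next
    assume "\<exists>n\<ge>1. \<sigma> ` {1..p + q} = {1..n}"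
    then show "\<exists>n. \<sigma> ` {1..p + q} = {1..<n}"
      by (metis atLeastLessThanSuc_atLeastAtMost)
  qed
  moreover have "{1..<p + 1} = {1..p}" "{p + 1..<p + q + 1} = {p + 1..p + q}" by auto
  ultimately show ?thesis
    unfolding quasi_def un is_qshuffle_def bij_betw_def by auto
qed

lemma comb_tree_eq_mixed_tree:
  "comb_tree d \<sigma> t s = mixed_tree d (comb_forest t s) {1..<length (right_branch t) + 1}
     {length (right_branch t) + 1..<length (right_branch t) + length (left_branch s) + 1} 1 \<sigma>"
proof -
  have "{1..<p + 1} \<union> {p + 1..<p + q + 1} = {1..p + q}" for p q :: nat by auto
  then show ?thesis
    by (simp add: comb_tree_def mixed_tree_def level_def level_forest_def[abs_def] Let_def del: One_nat_def)
qed

lemma right_comb_comb: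
  "right_comb (comb_decor t s) (comb_forest t s) 1 (length (right_branch t) + 1) t"
  by (simp add: right_comb_def comb_decor_def comb_forest_def Let_def)

lemma left_comb_comb:
  "left_comb (comb_decor t s) (comb_forest t s) (length (right_branch t) + 1)
     (length (right_branch t) + length (left_branch s) + 1) s"
  by (simp add: left_comb_def comb_decor_def comb_forest_def Let_def)

text \<open>The total \<open>n\<close> is separate from \<open>p + q\<close> because the theorem
  writes \<open>k + l + 2\<close> for \<open>(k + 1) + (l + 1)\<close>.\<close>

lemma Collect_quasi_level:
  assumes "0 < n" "p + q = n"
  shows "{\<sigma>. quasi e {1..<p + 1} {p + 1..<p + q + 1} 1 \<sigma> \<and>
      level ({1..<p + 1} \<union> {p + 1..<p + q + 1}) 1 \<sigma> = C}
    = {\<sigma>. \<sigma> \<in> (if e then Sh p q else QSh p q) \<and> {i \<in> {1..n}. \<sigma> i = 1} = C}"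
proof -
  have un: "{1..<p + 1} \<union> {p + 1..<p + q + 1} = {1..n}" using assms(2) by auto
  have pos: "0 < p + q" using assms by simp
  show ?thesis
    unfolding un quasi_iff_is_qshuffle[OF pos] level_def Sh_def QSh_def by (cases e) simp_all
qed

theorem corollary25:
  fixes t s :: "'w ptree" and k l :: nat and add :: "'w \<Rightarrow> 'w \<Rightarrow> 'w"
  assumes k: "length (right_branch t) = k + 1"
    and l: "length (left_branch s) = l + 1"
  shows
    "(dend_lt (basis t) (basis s) =
        (\<Sum>\<sigma> | \<sigma> \<in> Sh (k + 1) (l + 1) \<and> {i \<in> {1..k + l + 2}. \<sigma> i = 1} = {1}.
           basis (shuffle_tree \<sigma> t s) :: 'w ptree \<Rightarrow>\<^sub>0 'k::field) \<and>
      dend_gt (basis t) (basis s) =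
        (\<Sum>\<sigma> | \<sigma> \<in> Sh (k + 1) (l + 1) \<and> {i \<in> {1..k + l + 2}. \<sigma> i = 1} = {k + 2}.
           basis (shuffle_tree \<sigma> t s) :: 'w ptree \<Rightarrow>\<^sub>0 'k)) \<and>
     (semigroup add \<longrightarrow>
      tri_lt add (basis t) (basis s) =
        (\<Sum>\<sigma> | \<sigma> \<in> QSh (k + 1) (l + 1) \<and> {i \<in> {1..k + l + 2}. \<sigma> i = 1} = {1}.
           basis (qshuffle_tree add \<sigma> t s) :: 'w ptree \<Rightarrow>\<^sub>0 'k) \<and>
      tri_gt add (basis t) (basis s) =
        (\<Sum>\<sigma> | \<sigma> \<in> QSh (k + 1) (l + 1) \<and> {i \<in> {1..k + l + 2}. \<sigma> i = 1} = {k + 2}.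
           basis (qshuffle_tree add \<sigma> t s) :: 'w ptree \<Rightarrow>\<^sub>0 'k) \<and>
      tri_dot add (basis t) (basis s) =
        (\<Sum>\<sigma> | \<sigma> \<in> QSh (k + 1) (l + 1) \<and> {i \<in> {1..k + l + 2}. \<sigma> i = 1} = {1, k + 2}.
           basis (qshuffle_tree add \<sigma> t s) :: 'w ptree \<Rightarrow>\<^sub>0 'k))"
proof -
  let ?A = "{1..<k + 1 + 1}" and ?B = "{k + 1 + 1..<k + 1 + (l + 1) + 1}"
  let ?D = "comb_decor t s" and ?F = "comb_forest t s"
  \<comment> \<open>For shuffles all fibres over the ladder are singletons. In \<open>?d2\<close>,
    \<open>Min\<close> and \<open>Max\<close> recover the label of \<open>t\<close> and that of
    \<open>s\<close> from a pair.\<close>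
  let ?d = "\<lambda>X. ?D (the_elem X)"
  let ?d2 = "\<lambda>X. if is_singleton X then ?D (the_elem X) else add (?D (Min X)) (?D (Max X))"
  note r = right_comb_comb[of t s, unfolded k] and lc = left_comb_comb[of t s, unfolded k l]
  have sums: "(rooted_sum e d ?F ?A ?B 1 C :: 'w ptree \<Rightarrow>\<^sub>0 'k) =
      (\<Sum>\<sigma> | \<sigma> \<in> (if e then Sh (k + 1) (l + 1) else QSh (k + 1) (l + 1)) \<and>
          {i \<in> {1..k + l + 2}. \<sigma> i = 1} = C. basis (comb_tree d \<sigma> t s))" for e d C
    unfolding rooted_sum_def comb_tree_eq_mixed_tree k l
    by (subst Collect_quasi_level[where n = "k + l + 2"]) simp_all
  \<comment> \<open>A zero third product turns the three-term recursion into the dendriform one; the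
    last conjunct is then vacuous.\<close>
  have dend: "dend_lt0 t s = (rooted_sum True ?d ?F ?A ?B 1 {1} :: 'w ptree \<Rightarrow>\<^sub>0 'k) \<and>
      dend_gt0 t s = (rooted_sum True ?d ?F ?A ?B 1 {k + 1 + 1} :: 'w ptree \<Rightarrow>\<^sub>0 'k) \<and>
      (\<not> True \<longrightarrow> 0 = (rooted_sum True ?d ?F ?A ?B 1 {1, k + 1 + 1} :: 'w ptree \<Rightarrow>\<^sub>0 'k))"
    by (rule products_eq_rooted_sums[where lt = dend_lt0 and gt = dend_gt0 and dt = "\<lambda>_ _. 0"
          and D = ?D and d = ?d and e = True and add = add, OF _ _ _ _ _ r lc])
      (auto split: list.split)
  have tri: "tri_lt0 add t s = (rooted_sum False ?d2 ?F ?A ?B 1 {1} :: 'w ptree \<Rightarrow>\<^sub>0 'k) \<and>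
      tri_gt0 add t s = (rooted_sum False ?d2 ?F ?A ?B 1 {k + 1 + 1} :: 'w ptree \<Rightarrow>\<^sub>0 'k) \<and>
      (\<not> False \<longrightarrow>
        tri_dot0 add t s = (rooted_sum False ?d2 ?F ?A ?B 1 {1, k + 1 + 1} :: 'w ptree \<Rightarrow>\<^sub>0 'k))"
    by (rule products_eq_rooted_sums[where lt = "tri_lt0 add" and gt = "tri_gt0 add"
          and dt = "tri_dot0 add" and D = ?D and d = ?d2 and e = False and add = add, OF _ _ _ _ _ r lc])
      (auto split: list.split simp: is_singleton_def)
  \<comment> \<open>The first label of the second block in the form used by the theorem.\<close>
  have "k + 1 + 1 = k + 2" by simp
  with dend tri show ?thesis
    unfolding sums dend_lt_def dend_gt_def tri_lt_def tri_gt_def tri_dot_def bilin_ext_basis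
      shuffle_tree_def qshuffle_tree_def
    by (simp only: simp_thms if_True if_False)
qed

end
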